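(* Let $\tau$ be in the upper half-plane and let $q=e^{2\pi i\tau}$. For every non-negative integer $\nu$, $$S_3(2\nu+1)=-\sum_{n=1}^{2\nu-1}\frac{|B_{n+1}|}{n+1}\,2^{n+1}\binom{2\nu}{n}S_3(2\nu-n)+\frac{1}{2\nu+1}S_3(2\nu+1)-2\sum_{l=1}^{\nu}\binom{2\nu}{2l-1}2^{2l}\,S_3(2(\nu-l)+1)\,\Phi_{2l-1}(q).$$ Moreover, $$\vartheta_1^{(2\nu+1)}(0)=2(-1)^{\nu}S_3(2\nu+1),$$ where $\vartheta_1^{(k)}$ denotes the $k$-th derivative with respect to $z$ of the function $\vartheta_1(z)$ defined in the context.
   Context: For $\tau$ in the upper half-plane and $q=e^{2\pi i\tau}$, fractional powers of $q$ are $q^{s}:=e^{2\pi i\tau s}$. For a non-negative integer $m$, $$S_3(m)=\sum_{\alpha\in\mathbb{Z},\ \alpha\equiv 1\ (\mathrm{mod}\ 4)}q^{\alpha^2/8}\alpha^m .$$ For a positive integer $k$, $$\Phi_{k}(q)=\sum_{n=1}^{\infty}\frac{n^{k}q^n}{1-q^n}.$$ $B_n$ is the $n$-th Bernoulli number ($B_2=1/6$, $B_4=-1/30$, and $B_n=0$ for odd $n\ge 3$). The theta function (with nome $q^{1/2}=e^{\pi i\tau}$) is $$\vartheta_1(z)=2\sum_{n=0}^{\infty}(-1)^n q^{(n+1/2)^2/2}\sin((2n+1)z).$$ Empty sums are $0$.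
   Formalization: In the first sum, −|B_{n+1}| is replaced by the signed +B_{n+1}; the printed sign is false: for ν=1, dividing by q^{1/8} and letting Im τ→∞ would give 1 = −1/3. *)

theory Defs
  imports "HOL-Complex_Analysis.Complex_Analysis" "HOL-Number_Theory.Cong"
begin

text \<open>
  Fractional powers of \<open>q = exp (2 \<pi> \<i> \<tau>)\<close> depend on \<open>\<tau>\<close>, not only on \<open>q\<close>, so \<open>\<tau>\<close> is the parameter.
\<close>
definition qpow :: "complex \<Rightarrow> real \<Rightarrow> complex" where
  "qpow \<tau> s = exp (2 * of_real pi * \<i> * \<tau> * of_real s)"

definition S3 :: "complex \<Rightarrow> nat \<Rightarrow> complex" where
  "S3 \<tau> m = (\<Sum>\<^sub>\<infinity>\<alpha> | [\<alpha> = 1] (mod (4::int)). qpow \<tau> ((of_int \<alpha>)\<^sup>2 / 8) * of_int \<alpha> ^ m)"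

definition Phi :: "nat \<Rightarrow> complex \<Rightarrow> complex" where
  "Phi k q = (\<Sum>n. of_nat (Suc n) ^ k * q ^ Suc n / (1 - q ^ Suc n))"

definition theta1 :: "complex \<Rightarrow> complex \<Rightarrow> complex" where
  "theta1 \<tau> z =
     2 * (\<Sum>n. (-1) ^ n * qpow \<tau> ((of_nat n + 1 / 2)\<^sup>2 / 2) * sin (of_nat (2 * n + 1) * z))"

text \<open>
  Signed Bernoulli numbers, by the recurrence \<open>(\<Sum>k\<le>n. (n + 1 choose k) * B k) = 0\<close> for \<open>n \<ge> 1\<close>.
\<close>
fun bernoulli :: "nat \<Rightarrow> real" where
  "bernoulli n =
     (if n = 0 then 1
      else - (\<Sum>k<n. of_nat (Suc n choose k) * bernoulli k) / of_nat (Suc n))"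

declare bernoulli.simps [simp del]

lemma bernoulli_2: "bernoulli 2 = 1 / 6"
  by (simp add: bernoulli.simps numeral_eq_Suc)

lemma bernoulli_4: "bernoulli 4 = - (1 / 30)"
  by (simp add: bernoulli.simps numeral_eq_Suc binomial_Suc_Suc)

text \<open>
  Pitfall: in the recurrence for \<open>S3 \<tau> (2 * \<nu> + 1)\<close>, the first sum carries the signed coefficients
  \<open>+ B (n + 1) / (n + 1)\<close>.  The identity is also found in print with
  \<open>- \<bar>B (n + 1)\<bar> / (n + 1)\<close>, which is false: for \<open>\<nu> = 1\<close>, after division by
  \<open>qpow \<tau> (1 / 8)\<close>, the limit \<open>Im \<tau> \<rightarrow> \<infinity>\<close> would give \<open>1 = - (1 / 3)\<close>.
\<close>

end

(*
  Let b n = (-1)^n q^((2n+1)^2/8) for integers n, so that the moments A k = sum_n b n (2n+1)^k are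
  2 S3(k) for odd k and 0 for even k.  The logarithmic derivative
    theta1'/theta1 (z) = cot z + 4 sum_m q^m/(1-q^m) sin(2mz),
  multiplied by theta1 and read off at a single Fourier coefficient, becomes
    n b n + c n + s n = 0,  c n = sum_{k<=n} b k,  s n = sum_{m>=1} q^m/(1-q^m) (b(n-m) - b(n+m)).
  No product formula is needed: since b n = - q^n b(n-1), the left-hand side h n satisfies
  h n = - q^n h(n-1), while b(-1-n) = - b n gives h(-1) = h 0; for n = 0 this forces h 0 = 0,
  hence h = 0.

  Now take moments against (2n+1)^(2 nu).  Those of s are binomial combinations of Phi(j) A(2 nu - j).
  Those of c follow by summation by parts (c n - c(n-1) = b n) against a polynomial P with
  P(x+2) - P(x) = 2 x^(2 nu), namely a rescaled Bernoulli polynomial.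
*)
theory Submission
  imports Defs
begin

section \<open>Infinite sums\<close>

lemma has_sum_diff:
  fixes f g :: "'a \<Rightarrow> 'b::topological_ab_group_add"
  assumes "(f has_sum a) A" "(g has_sum b) A"
  shows "((\<lambda>x. f x - g x) has_sum (a - b)) A"
  using has_sum_add[OF assms(1), of "\<lambda>x. - g x" "- b"] assms(2) by (simp add: has_sum_uminus)

lemma has_sum_finite_sum:
  fixes f :: "'i \<Rightarrow> 'a \<Rightarrow> 'b::topological_comm_monoid_add"
  assumes "\<And>i. i \<in> I \<Longrightarrow> (f i has_sum s i) A"
  shows "((\<lambda>x. \<Sum>i\<in>I. f i x) has_sum (\<Sum>i\<in>I. s i)) A"
  using assms by (induction I rule: infinite_finite_induct) (auto intro!: has_sum_add)

text \<open>For complex families summability and absolute summability coincide, so the norms are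
  summable over the product and the double sum may be taken row by row.\<close>

lemma has_sum_product_complex:
  fixes f :: "'a \<Rightarrow> complex" and g :: "'b \<Rightarrow> complex"
  assumes f: "(f has_sum a) A" and g: "(g has_sum b) B"
  shows "((\<lambda>(x, y). f x * g y) has_sum (a * b)) (A \<times> B)"
proof (rule has_sum_SigmaI)
  show "((\<lambda>y. case (x, y) of (x, y) \<Rightarrow> f x * g y) has_sum f x * b) B" for x
    using has_sum_cmult_right[OF g] by simp
  show "((\<lambda>x. f x * b) has_sum a * b) A"
    using has_sum_cmult_left[OF f] .
  have nf: "(\<lambda>x. norm (f x)) summable_on A" and ng: "(\<lambda>x. norm (g x)) summable_on B"
    using assms by (auto simp: summable_on_iff_abs_summable_on_complex[symmetric] has_sum_imp_summable)
  have "(\<lambda>p. norm (case p of (x, y) \<Rightarrow> f x * g y)) summable_on A \<times> B"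
    unfolding Infinite_Sum.abs_summable_on_Sigma_iff
  proof (intro conjI ballI)
    show "(\<lambda>y. norm (case (x, y) of (x, y) \<Rightarrow> f x * g y)) summable_on B" for x
      using summable_on_cmult_right[OF ng] by (simp add: norm_mult)
    have "(\<lambda>x. norm (f x) * \<bar>infsum (\<lambda>y. norm (g y)) B\<bar>) summable_on A"
      by (rule summable_on_cmult_left[OF nf])
    then show "(\<lambda>x. norm (\<Sum>\<^sub>\<infinity>y\<in>B. norm (case (x, y) of (x, y) \<Rightarrow> f x * g y))) summable_on A"
      by (simp add: norm_mult infsum_cmult_right' abs_mult)
  qed
  then show "(\<lambda>(x, y). f x * g y) summable_on A \<times> B"
    by (simp add: summable_on_iff_abs_summable_on_complex)
qed

lemma summable_power_times_geometric:
  fixes x :: real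
  assumes "0 \<le> x" "x < 1"
  shows "summable (\<lambda>n. of_nat (Suc n) ^ k * x ^ Suc n)"
proof (cases "x = 0")
  case False
  then have x: "0 < x" using assms by simp
  have "(\<lambda>n. norm (of_nat (Suc (Suc n)) ^ k * x ^ Suc (Suc n)) / norm (of_nat (Suc n) ^ k * x ^ Suc n))
     \<longlonglongrightarrow> x"
  proof -
    have "(\<lambda>n. (of_nat (Suc (Suc n)) / of_nat (Suc n)) ^ k * x) \<longlonglongrightarrow> 1 ^ k * x"
      by (intro tendsto_intros) (use LIMSEQ_Suc_n_over_n[THEN LIMSEQ_Suc] in simp)
    moreover have "norm (of_nat (Suc (Suc n)) ^ k * x ^ Suc (Suc n)) / norm (of_nat (Suc n) ^ k * x ^ Suc n)
       = (of_nat (Suc (Suc n)) / of_nat (Suc n)) ^ k * x" for n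
      using x by (simp add: abs_mult power_divide power_abs del: of_nat_Suc)
    ultimately show ?thesis by (simp del: of_nat_Suc)
  qed
  \<comment> \<open>The midpoint of x and 1 lies strictly above the limit of the ratios and strictly
    below 1, as the ratio test requires.\<close>
  moreover have "x < (1 + x) / 2" using assms by simp
  ultimately have "eventually (\<lambda>n. norm (of_nat (Suc (Suc n)) ^ k * x ^ Suc (Suc n)) / norm (of_nat (Suc n) ^ k * x ^ Suc n)
      < (1 + x) / 2) sequentially"
    by (rule order_tendstoD(2))
  then obtain N where N: "norm (of_nat (Suc (Suc n)) ^ k * x ^ Suc (Suc n)) / norm (of_nat (Suc n) ^ k * x ^ Suc n)
      < (1 + x) / 2" if "n \<ge> N" for n
    by (auto simp: eventually_sequentially)
  show ?thesis
  proof (rule summable_ratio_test)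
    show "(1 + x) / 2 < 1" using assms by simp
    show "norm (of_nat (Suc (Suc n)) ^ k * x ^ Suc (Suc n)) \<le> (1 + x) / 2 * norm (of_nat (Suc n) ^ k * x ^ Suc n)"
      if "n \<ge> N" for n
    proof -
      have "0 < norm (of_nat (Suc n) ^ k * x ^ Suc n)"
        using x by simp
      then show ?thesis
        using N[OF that] by (simp only: pos_divide_less_eq less_imp_le)
    qed
  qed
qed simp

text \<open>Cuts the integers into the ray going down from \<open>n\<close> and the ray going up
  from \<open>n + 1\<close>. The cut \<open>n = - 1\<close> folds moments by reflection; a general
  cut relates the two tails of \<open>b\<close>.\<close>

lemma has_sum_int_split:
  fixes f :: "int \<Rightarrow> 'a :: topological_comm_monoid_add"
  assumes "((\<lambda>m::nat. f (n - int m)) has_sum a) UNIV" "((\<lambda>m::nat. f (n + int (Suc m))) has_sum b) UNIV"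
  shows "(f has_sum (a + b)) UNIV"
proof -
  have "(f has_sum a) {..n}"
    using assms(1)
    by (subst (asm) has_sum_reindex_bij_witness[where T = "{..n}" and i = "\<lambda>x. nat (n - x)"
          and j = "\<lambda>m. n - int m" and h = f and s' = a]) auto
  moreover have "(f has_sum b) {n<..}"
    using assms(2)
    by (subst (asm) has_sum_reindex_bij_witness[where T = "{n<..}" and i = "\<lambda>x. nat (x - n - 1)"
          and j = "\<lambda>m. n + int (Suc m)" and h = f and s' = b]) auto
  moreover have "{..n} \<union> {n<..} = UNIV" "{..n} \<inter> {n<..} = {}" by auto
  ultimately show ?thesis
    by (metis has_sum_Un_disjoint)
qed

section \<open>The Fourier coefficients of the theta function\<close>

lemma qpow_add: "qpow \<tau> (s + t) = qpow \<tau> s * qpow \<tau> t"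
  by (simp add: qpow_def exp_add[symmetric] algebra_simps)

lemma qpow_of_nat: "qpow \<tau> (of_nat n) = exp (2 * of_real pi * \<i> * \<tau>) ^ n"
  by (simp add: qpow_def exp_of_nat_mult[symmetric] algebra_simps)

lemma norm_qpow: "norm (qpow \<tau> s) = exp (- (2 * pi * Im \<tau> * s))"
  by (simp add: qpow_def)

section \<open>Symmetries and decay of the theta coefficients\<close>

locale upper_half_plane_point =
  fixes \<tau> :: complex
  assumes Im_pos: "Im \<tau> > 0"
begin

definition q :: complex where "q = exp (2 * of_real pi * \<i> * \<tau>)"

definition b :: "int \<Rightarrow> complex" where
  "b n = (if even n then 1 else - 1) * qpow \<tau> ((of_int (2 * n + 1))\<^sup>2 / 8)"

lemma norm_q_less_1: "norm q < 1" and q_nonzero: "q \<noteq> 0"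
  using Im_pos by (simp_all add: q_def)

lemma one_minus_q_power_nonzero: "1 - q ^ Suc m \<noteq> 0"
proof
  assume "1 - q ^ Suc m = 0"
  then have "norm q ^ Suc m = 1"
    by (metis norm_one norm_power right_minus_eq)
  moreover have "norm q ^ Suc m < 1"
    using norm_q_less_1 by (intro power_Suc_less_one) (auto simp: q_nonzero)
  ultimately show False by simp
qed

lemma b_reflect: "b (- 1 - n) = - b n"
proof -
  have "(of_int (2 * (- 1 - n) + 1))\<^sup>2 = ((of_int (2 * n + 1))\<^sup>2 :: real)"
    by (simp add: power2_eq_square algebra_simps)
  then show ?thesis by (simp add: b_def)
qed

text \<open>Consecutive odd squares satisfy (2n+1)^2 - (2n-1)^2 = 8n, and the parity sign
  flips.\<close>

lemma b_shift: "b n = - (qpow \<tau> (of_int n) * b (n - 1))"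
proof -
  have *: "(of_int (2 * n + 1))\<^sup>2 / 8 = of_int n + (of_int (2 * (n - 1) + 1))\<^sup>2 / (8 :: real)"
    by (simp add: power2_eq_square field_simps)
  show ?thesis by (simp only: b_def * qpow_add) simp
qed

lemma norm_b: "norm (b n) = exp (- (pi * Im \<tau> / 4 * (of_int (2 * n + 1))\<^sup>2))"
  by (simp add: b_def norm_mult norm_qpow)

text \<open>A nonzero integer is at most its square in absolute value. Trading Gaussian for
  exponential decay makes geometric majorants available.\<close>

lemma norm_b_le: "norm (b n) \<le> exp (- (pi * Im \<tau> / 4 * \<bar>of_int (2 * n + 1)\<bar>))"
proof -
  have "\<bar>2 * n + 1\<bar> * 1 \<le> \<bar>2 * n + 1\<bar> * \<bar>2 * n + 1\<bar>"
    by (intro mult_left_mono) presburger+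
  then have "\<bar>2 * n + 1\<bar> \<le> (2 * n + 1)\<^sup>2"
    by (simp add: power2_eq_square flip: abs_mult)
  then have "\<bar>of_int (2 * n + 1)\<bar> \<le> ((of_int (2 * n + 1))\<^sup>2 :: real)"
    by (metis of_int_abs of_int_le_iff of_int_power)
  then show ?thesis
    using Im_pos by (simp add: norm_b)
qed

lemma summable_b_half: "summable (\<lambda>n. norm (of_nat (2 * n + 1) ^ k * b (int n)))"
proof (rule summable_comparison_test')
  define x where "x = exp (- (pi * Im \<tau> / 4))"
  have x: "0 < x" "x < 1" using Im_pos by (auto simp: x_def)
  \<comment> \<open>The majorant comes from 2n+1 <= 2(n+1), which gives \<open>2 ^ k\<close>, and
    from x^(2n+1) <= x^(n+1).\<close>
  show "summable (\<lambda>n. 2 ^ k * (of_nat (Suc n) ^ k * x ^ Suc n))"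
    using x by (intro summable_mult summable_power_times_geometric) auto
  show "norm (norm (of_nat (2 * n + 1) ^ k * b (int n))) \<le> 2 ^ k * (of_nat (Suc n) ^ k * x ^ Suc n)" for n
  proof -
    have "norm (b (int n)) \<le> exp (- (pi * Im \<tau> / 4 * of_nat (2 * n + 1)))"
      using norm_b_le[of "int n"] by (simp add: add.commute)
    also have "\<dots> = x ^ (2 * n + 1)"
      by (simp only: x_def exp_of_nat_mult[symmetric]) (simp add: algebra_simps)
    also have "\<dots> \<le> x ^ Suc n"
      using x by (intro power_decreasing) auto
    finally have "norm (b (int n)) \<le> x ^ Suc n" .
    moreover have "(of_nat (2 * n + 1) :: real) ^ k \<le> (2 * of_nat (Suc n)) ^ k"
      by (intro power_mono) auto
    ultimately have "of_nat (2 * n + 1) ^ k * norm (b (int n)) \<le> (2 * of_nat (Suc n)) ^ k * x ^ Suc n"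
      using x by (intro mult_mono) auto
    then show ?thesis
      by (simp only: norm_mult norm_power norm_of_nat real_norm_def abs_norm_cancel abs_mult power_abs abs_of_nat abs_inverse power_mult_distrib mult.assoc)
  qed
qed

lemma has_sum_b_half:
  "((\<lambda>n. of_nat (2 * n + 1) ^ k * b (int n)) has_sum (\<Sum>n. of_nat (2 * n + 1) ^ k * b (int n))) UNIV"
  by (intro norm_summable_imp_has_sum summable_b_half summable_sums summable_norm_cancel[OF summable_b_half])

section \<open>Two-sided moments and their relation to \<open>S3\<close>\<close>

definition A :: "nat \<Rightarrow> complex" where
  "A k = (if odd k then 2 * (\<Sum>n. of_nat (2 * n + 1) ^ k * b (int n)) else 0)"

text \<open>The reflection n -> -1-n negates both 2n+1 and \<open>b n\<close>, so the negative half
  is \<open>- ((- 1) ^ k)\<close> times the nonnegative half: the halves double for odd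
  \<open>k\<close> and cancel for even \<open>k\<close>.\<close>

lemma has_sum_A: "((\<lambda>n. of_int (2 * n + 1) ^ k * b n) has_sum A k) UNIV"
proof -
  define H where "H = (\<Sum>n. of_nat (2 * n + 1) ^ k * b (int n))"
  have H: "((\<lambda>n. of_nat (2 * n + 1) ^ k * b (int n)) has_sum H) UNIV"
    unfolding H_def by (rule has_sum_b_half)
  have pos: "((\<lambda>m. of_int (2 * (- 1 + int (Suc m)) + 1) ^ k * b (- 1 + int (Suc m))) has_sum H) UNIV"
    using H by (simp add: add.commute)
  have eq: "of_int (2 * (- 1 - int m) + 1) ^ k * b (- 1 - int m)
     = (- ((- 1) ^ k)) * (of_nat (2 * m + 1) ^ k * b (int m))" for m
  proof -
    have "(of_int (2 * (- 1 - int m) + 1) :: complex) = (- 1) * of_nat (2 * m + 1)" by simp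
    then show ?thesis by (simp only: b_reflect power_mult_distrib) simp
  qed
  have neg: "((\<lambda>m. of_int (2 * (- 1 - int m) + 1) ^ k * b (- 1 - int m)) has_sum (- ((- 1) ^ k)) * H) UNIV"
    unfolding eq by (rule has_sum_cmult_right[OF H])
  have "A k = (- ((- 1) ^ k)) * H + H"
    by (simp add: A_def H_def)
  with has_sum_int_split[OF neg pos] show ?thesis by simp
qed

text \<open>The class of 1 modulo 4 contains exactly one of 2n+1 and -(2n+1), namely the one with
  sign (-1)^n. An odd power pulls this sign out, and it becomes the sign in
  \<open>b\<close>.\<close>

lemma S3_odd:
  assumes "odd k"
  shows "S3 \<tau> k = (\<Sum>n. of_nat (2 * n + 1) ^ k * b (int n))"
proof -
  \<comment> \<open>\<open>j\<close> enumerates the class as 1, -3, 5, -7, ...; its inverse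
    \<open>i\<close> reads the position off the absolute value.\<close>
  define j where "j = (\<lambda>n. (if even n then 1 else - 1) * (2 * int n + 1))"
  define i where "i = (\<lambda>\<alpha>. nat ((\<bar>\<alpha>\<bar> - 1) div 2))"
  define g where "g = (\<lambda>\<alpha>. qpow \<tau> ((of_int \<alpha>)\<^sup>2 / 8) * of_int \<alpha> ^ k)"
  have "(g has_sum (\<Sum>n. of_nat (2 * n + 1) ^ k * b (int n))) {\<alpha>. [\<alpha> = 1] (mod (4::int))}"
  proof (rule has_sum_reindex_bij_witness[THEN iffD1, OF _ _ _ _ _ _ has_sum_b_half])
    show "i (j n) = n" for n by (simp add: i_def j_def)
    show "j n \<in> {\<alpha>. [\<alpha> = 1] (mod 4)}" for n
      unfolding mem_Collect_eq j_def cong_def by (cases "even n") (simp, presburger)+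
    show "j (i \<alpha>) = \<alpha>" if "\<alpha> \<in> {\<alpha>. [\<alpha> = 1] (mod 4)}" for \<alpha>
    proof -
      have "\<alpha> mod 4 = 1" using that by (simp add: cong_def)
      then obtain t where t: "\<alpha> = 4 * t + 1"
        by (metis mult_div_mod_eq)
      show ?thesis
      proof (cases "t \<ge> 0")
        case True
        then have "i \<alpha> = nat (2 * t)" by (simp add: i_def t)
        then show ?thesis using True by (simp add: j_def t even_nat_iff)
      next
        case False
        then have "i \<alpha> = nat (- 2 * t - 1)" by (simp add: i_def t)
        then show ?thesis using False by (simp add: j_def t even_nat_iff)
      qed
    qed
    show "g (j n) = of_nat (2 * n + 1) ^ k * b (int n)" for n
    proof (cases "even n")
      case True
      then show ?thesis by (simp add: g_def j_def b_def add.commute)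
    next
      case False
      then have *: "j n = - (2 * int n + 1)" by (simp add: j_def)
      have "g (j n) = qpow \<tau> ((of_int (2 * int n + 1))\<^sup>2 / 8) * (- (of_int (2 * int n + 1) ^ k))"
        by (simp only: g_def * of_int_minus power2_minus power_minus_odd[OF assms])
      then show ?thesis using False by (simp add: b_def add.commute)
    qed
  qed auto
  then show ?thesis
    by (simp add: S3_def g_def infsumI)
qed

lemma A_odd: "odd k \<Longrightarrow> A k = 2 * S3 \<tau> k"
  by (simp add: A_def S3_odd)

lemma A_even: "even k \<Longrightarrow> A k = 0"
  by (simp add: A_def)

section \<open>Lambert series and the convolution \<open>s\<close>\<close>

definition r :: "nat \<Rightarrow> complex" where "r m = q ^ Suc m / (1 - q ^ Suc m)"

lemma has_sum_Phi: "((\<lambda>m. of_nat (Suc m) ^ k * r m) has_sum Phi k q) UNIV"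
proof -
  have *: "summable (\<lambda>m. norm (of_nat (Suc m) ^ k * r m))"
  proof (rule summable_comparison_test')
    \<comment> \<open>A lower bound for all denominators \<open>norm (1 - q ^ Suc m)\<close> at
      once.\<close>
    define c where "c = 1 - norm q"
    have c: "c > 0" using norm_q_less_1 by (simp add: c_def)
    show "summable (\<lambda>m. (of_nat (Suc m) ^ k * norm q ^ Suc m) * inverse c)"
      using norm_q_less_1 by (intro summable_mult2 summable_power_times_geometric) auto
    fix m
    have "norm q ^ Suc m \<le> norm q ^ 1"
      using norm_q_less_1 by (intro power_decreasing) auto
    then have "c \<le> norm (1 - q ^ Suc m)"
      using norm_triangle_ineq2[of 1 "q ^ Suc m"] by (simp add: c_def norm_power norm_mult)
    then have "inverse (norm (1 - q ^ Suc m)) \<le> inverse c"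
      using c by (intro le_imp_inverse_le)
    then have "(of_nat (Suc m) ^ k * norm q ^ Suc m) * inverse (norm (1 - q ^ Suc m))
          \<le> (of_nat (Suc m) ^ k * norm q ^ Suc m) * inverse c"
      by (intro mult_left_mono) auto
    then show "norm (norm (of_nat (Suc m) ^ k * r m)) \<le> (of_nat (Suc m) ^ k * norm q ^ Suc m) * inverse c"
      by (simp only: r_def norm_mult norm_power norm_of_nat real_norm_def abs_norm_cancel abs_mult power_abs abs_of_nat abs_inverse divide_inverse norm_inverse mult.assoc)
  qed
  have "Phi k q = (\<Sum>m. of_nat (Suc m) ^ k * r m)"
    by (simp add: Phi_def r_def)
  then show ?thesis
    by (simp only:) (intro norm_summable_imp_has_sum * summable_sums summable_norm_cancel[OF *])
qed

text \<open>Substituting N = n + e(m+1) separates \<open>r\<close> from \<open>b\<close>; the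
  binomial expansion of (2n+1 + 2e(m+1))^k then makes the double sum a finite combination of
  products of \<open>Phi\<close> and \<open>A\<close>. The sign \<open>e\<close> covers both halves
  of \<open>s\<close>.\<close>

lemma has_sum_r_b_shift:
  fixes e :: int
  assumes "\<bar>e\<bar> = 1"
  shows "((\<lambda>(m, N). of_int (2 * N + 1) ^ k * (r m * b (N - e * int (Suc m)))) has_sum
           (\<Sum>j\<le>k. of_nat (k choose j) * (2 * of_int e) ^ j * Phi j q * A (k - j))) (UNIV \<times> UNIV)"
    (is "(?f has_sum ?S) _")
proof -
  have "((\<lambda>(m, n). of_nat (k choose j) * (2 * of_int e) ^ j *
            ((of_nat (Suc m) ^ j * r m) * (of_int (2 * n + 1) ^ (k - j) * b n)))
         has_sum of_nat (k choose j) * (2 * of_int e) ^ j * Phi j q * A (k - j)) (UNIV \<times> UNIV)" for j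
    using has_sum_cmult_right[where c = "of_nat (k choose j) * (2 * of_int e) ^ j",
        OF has_sum_product_complex[OF has_sum_Phi[of j] has_sum_A[of "k - j"]]]
    by (simp only: case_prod_unfold mult.assoc)
  then have "((\<lambda>p. \<Sum>j\<le>k. (\<lambda>(m, n). of_nat (k choose j) * (2 * of_int e) ^ j *
            ((of_nat (Suc m) ^ j * r m) * (of_int (2 * n + 1) ^ (k - j) * b n))) p)
         has_sum ?S) (UNIV \<times> UNIV)"
    by (rule has_sum_finite_sum)
  also have "(\<lambda>p. \<Sum>j\<le>k. (\<lambda>(m, n). of_nat (k choose j) * (2 * of_int e) ^ j *
            ((of_nat (Suc m) ^ j * r m) * (of_int (2 * n + 1) ^ (k - j) * b n))) p)
      = (\<lambda>(m, n). of_int (2 * (n + e * int (Suc m)) + 1) ^ k * (r m * b n))"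
  proof (intro ext, clarify)
    fix m n
    have "of_int (2 * (n + e * int (Suc m)) + 1) ^ k
        = (2 * of_int e * of_nat (Suc m) + of_int (2 * n + 1) :: complex) ^ k"
      by (simp add: algebra_simps)
    also have "\<dots> = (\<Sum>j\<le>k. of_nat (k choose j) * (2 * of_int e * of_nat (Suc m)) ^ j * of_int (2 * n + 1) ^ (k - j))"
      by (rule binomial_ring)
    finally have eq: "of_int (2 * (n + e * int (Suc m)) + 1) ^ k =
      (\<Sum>j\<le>k. of_nat (k choose j) * (2 * of_int e * of_nat (Suc m)) ^ j * of_int (2 * n + 1) ^ (k - j) :: complex)" .
    show "(\<Sum>j\<le>k. of_nat (k choose j) * (2 * of_int e) ^ j *
            ((of_nat (Suc m) ^ j * r m) * (of_int (2 * n + 1) ^ (k - j) * b n)))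
      = of_int (2 * (n + e * int (Suc m)) + 1) ^ k * (r m * b n)"
      unfolding eq sum_distrib_right power_mult_distrib by (intro sum.cong refl) (simp only: mult_ac)
  qed
  finally have *: "((\<lambda>(m, n). of_int (2 * (n + e * int (Suc m)) + 1) ^ k * (r m * b n)) has_sum ?S) (UNIV \<times> UNIV)" .
  show ?thesis
    by (rule has_sum_reindex_bij_witness[where j = "\<lambda>(m, N). (m, N - e * int (Suc m))"
          and i = "\<lambda>(m, n). (m, n + e * int (Suc m))", THEN iffD2, OF _ _ _ _ _ _ *])
       auto
qed

definition s :: "int \<Rightarrow> complex" where
  "s n = (\<Sum>\<^sub>\<infinity>m. r m * (b (n - int (Suc m)) - b (n + int (Suc m))))"

text \<open>Each slice of a summable double family is summable; \<open>has_sum_r_b_shift\<close>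
  with exponent 0 supplies the family.\<close>

lemma summable_on_r_b: "\<bar>e\<bar> = 1 \<Longrightarrow> (\<lambda>m. r m * b (n - e * int (Suc m))) summable_on UNIV"
  using has_sum_swap[THEN iffD1, OF has_sum_r_b_shift[of e 0], THEN has_sum_imp_summable]
    summable_on_SigmaD1[of "\<lambda>N m. r m * b (N - e * int (Suc m))" UNIV "\<lambda>_. UNIV" n]
  by simp

lemma has_sum_s: "((\<lambda>m. r m * (b (n - int (Suc m)) - b (n + int (Suc m)))) has_sum s n) UNIV"
proof -
  have "(\<lambda>m. r m * (b (n - int (Suc m)) - b (n + int (Suc m)))) summable_on UNIV"
    using has_sum_diff[OF summable_on_r_b[of 1 n, THEN has_sum_infsum] summable_on_r_b[of "- 1" n, THEN has_sum_infsum]]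
    by (simp add: right_diff_distrib has_sum_imp_summable del: of_nat_Suc)
  then show ?thesis unfolding s_def by (rule has_sum_infsum)
qed

text \<open>The two halves of \<open>s\<close> are the cases \<open>e = 1\<close> and
  \<open>e = - 1\<close>; subtracting them produces the factor \<open>1 - (- 1) ^ j\<close>, and
  swapping the order of summation lets the inner sum over \<open>m\<close> become
  \<open>s N\<close>.\<close>

lemma has_sum_s_moment:
  "((\<lambda>N. of_int (2 * N + 1) ^ k * s N) has_sum
     (\<Sum>j\<le>k. of_nat (k choose j) * (1 - (- 1) ^ j) * 2 ^ j * Phi j q * A (k - j))) UNIV"
proof -
  define T where "T e = (\<Sum>j\<le>k. of_nat (k choose j) * (2 * of_int e) ^ j * Phi j q * A (k - j))" for e
  have "((\<lambda>p. (case p of (m, N) \<Rightarrow> of_int (2 * N + 1) ^ k * (r m * b (N - 1 * int (Suc m))))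
         - (case p of (m, N) \<Rightarrow> of_int (2 * N + 1) ^ k * (r m * b (N - (- 1) * int (Suc m)))))
         has_sum (T 1 - T (- 1))) (UNIV \<times> UNIV)"
    unfolding T_def by (intro has_sum_diff has_sum_r_b_shift) auto
  also have "(\<lambda>p. (case p of (m, N) \<Rightarrow> of_int (2 * N + 1) ^ k * (r m * b (N - 1 * int (Suc m))))
         - (case p of (m, N) \<Rightarrow> of_int (2 * N + 1) ^ k * (r m * b (N - (- 1) * int (Suc m)))))
       = (\<lambda>(m, N). of_int (2 * N + 1) ^ k * (r m * (b (N - int (Suc m)) - b (N + int (Suc m)))))"
    by (simp add: fun_eq_iff right_diff_distrib del: of_nat_Suc)
  finally have "((\<lambda>(N, m). of_int (2 * N + 1) ^ k * (r m * (b (N - int (Suc m)) - b (N + int (Suc m)))))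
     has_sum (T 1 - T (- 1))) (UNIV \<times> UNIV)"
    by (subst (asm) has_sum_swap) simp
  then have "((\<lambda>N. of_int (2 * N + 1) ^ k * s N) has_sum (T 1 - T (- 1))) UNIV"
    by (rule has_sum_SigmaD) (simp only: prod.case has_sum_cmult_right has_sum_s)
  also have "T 1 - T (- 1) = (\<Sum>j\<le>k. of_nat (k choose j) * (1 - (- 1) ^ j) * 2 ^ j * Phi j q * A (k - j))"
  proof -
    have "(2 * of_int (- 1)) ^ j = (- 1) ^ j * (2 :: complex) ^ j" for j
      by (simp add: power_mult_distrib[symmetric])
    then show ?thesis
      unfolding T_def sum_subtractf[symmetric] by (intro sum.cong refl) (simp add: algebra_simps)
  qed
  finally show ?thesis .
qed

section \<open>Partial sums of the theta coefficients\<close>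

definition c :: "int \<Rightarrow> complex" where "c n = (\<Sum>\<^sub>\<infinity>m. b (n - int m))"

lemma summable_on_b: "b summable_on UNIV"
  using has_sum_A[of 0] by (simp add: has_sum_imp_summable)

lemma has_sum_c: "((\<lambda>m. b (n - int m)) has_sum c n) UNIV"
proof -
  have "b summable_on range (\<lambda>m. n - int m)"
    using summable_on_b by (rule summable_on_subset) auto
  then have "(b \<circ> (\<lambda>m. n - int m)) summable_on UNIV"
    by (rule summable_on_reindex[THEN iffD1, rotated]) (auto simp: inj_on_def)
  then show ?thesis unfolding c_def o_def by (rule has_sum_infsum)
qed

lemma c_step: "c n = b n + c (n - 1)"
proof -
  have "(\<lambda>m. b (n - int m)) sums c n" "(\<lambda>m. b (n - 1 - int m)) sums c (n - 1)"
    by (rule has_sum_imp_sums[OF has_sum_c])+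
  then show ?thesis
    using sums_Suc_iff[of "\<lambda>m. b (n - int m)" "c (n - 1)"] sums_unique2[of "\<lambda>m. b (n - int m)"]
    by (simp add: algebra_simps)
qed

text \<open>The whole family \<open>b\<close> sums to \<open>A 0\<close>, which is 0, so the upper
  tail is the negative of the lower one.\<close>

lemma has_sum_c_above: "((\<lambda>m. b (n + int (Suc m))) has_sum - c n) UNIV"
proof -
  have "b summable_on range (\<lambda>m. n + int (Suc m))"
    using summable_on_b by (rule summable_on_subset) auto
  then have "(b \<circ> (\<lambda>m. n + int (Suc m))) summable_on UNIV"
    by (rule summable_on_reindex[THEN iffD1, rotated]) (auto simp: inj_on_def)
  then obtain d where d: "((\<lambda>m. b (n + int (Suc m))) has_sum d) UNIV"
    unfolding o_def summable_on_def by blast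
  have "(b has_sum 0) UNIV" using has_sum_A[of 0] by (simp add: A_even)
  with has_sum_int_split[OF has_sum_c d] have "c n + d = 0"
    by (rule has_sum_unique)
  then have "d = - c n" by (simp add: eq_neg_iff_add_eq_0 add.commute)
  with d show ?thesis by simp
qed

section \<open>The identity between Fourier coefficients\<close>

lemma s_reflect: "s (- 1 - n) = s n"
proof -
  have "b (- 1 - n - int (Suc m)) = - b (n + int (Suc m))"
    "b (- 1 - n + int (Suc m)) = - b (n - int (Suc m))" for m
    using b_reflect[of "n + int (Suc m)"] b_reflect[of "n - int (Suc m)"] by (simp_all add: algebra_simps)
  then show ?thesis by (simp add: s_def del: of_nat_Suc)
qed

text \<open>By \<open>b_shift\<close>, combining the terms for \<open>n\<close> and
  \<open>n - 1\<close> creates a factor 1 - q^(m+1), which cancels the denominator of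
  \<open>r m\<close>. What remains are bare tails of \<open>b\<close>, summed by
  \<open>has_sum_c\<close> and \<open>has_sum_c_above\<close>.\<close>

lemma s_shift: "s n + qpow \<tau> (of_int n) * s (n - 1) = - (qpow \<tau> (of_int n) * c (n - 2)) - c n"
proof -
  define Q where "Q = qpow \<tau> (of_int n)"
  have "((\<lambda>m. - (Q * b (n - 2 - int m)) + b (n + int (Suc m))) has_sum (- (Q * c (n - 2)) + - c n)) UNIV"
    by (intro has_sum_add has_sum_cmult_right has_sum_c has_sum_c_above has_sum_uminus[THEN iffD2])
       (simp add: has_sum_cmult_right has_sum_c)
  also have "(\<lambda>m. - (Q * b (n - 2 - int m)) + b (n + int (Suc m))) =
    (\<lambda>m. r m * (b (n - int (Suc m)) - b (n + int (Suc m)))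
      + Q * (r m * (b (n - 1 - int (Suc m)) - b (n - 1 + int (Suc m)))))"
  proof
    fix m
    define M where "M = int (Suc m)"
    define x where "x = q ^ Suc m"
    have x: "qpow \<tau> (of_int M) = x"
      unfolding M_def x_def q_def using qpow_of_nat[of \<tau> "Suc m"] by simp
    have "Q = qpow \<tau> (of_int (n - M)) * x" "qpow \<tau> (of_int (n + M)) = Q * x"
      by (simp_all add: x[symmetric] Q_def qpow_add[symmetric])
    moreover have "b (n - M) = - (qpow \<tau> (of_int (n - M)) * b (n - 1 - M))"
      "b (n + M) = - (qpow \<tau> (of_int (n + M)) * b (n - 1 + M))"
      using b_shift[of "n - M"] b_shift[of "n + M"] by (simp_all add: algebra_simps)
    ultimately have 1: "Q * b (n - 1 - M) = - (x * b (n - M))" and 2: "b (n + M) = - (x * (Q * b (n - 1 + M)))"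
      by simp_all
    have R: "r m * (1 - x) = x"
      unfolding r_def x_def using one_minus_q_power_nonzero[of m] by simp
    have "x \<noteq> 0" by (simp add: x_def q_nonzero)
    \<comment> \<open>The extra factor \<open>x\<close> avoids its inverse: \<open>2\<close> gives
      \<open>x * (Q * b (n - 1 + M))\<close>, not \<open>Q * b (n - 1 + M)\<close> alone.\<close>
    have "x * (r m * b (n - M) + r m * (Q * b (n - 1 - M)) - r m * b (n + M) - r m * (Q * b (n - 1 + M)))
      = x * ((r m * (1 - x)) * b (n - M)) + (r m * (1 - x)) * b (n + M)"
      unfolding 1 2 by (simp add: algebra_simps)
    also have "\<dots> = x * (- (Q * b (n - 1 - M)) + b (n + M))"
      unfolding R 1 by (simp add: algebra_simps)
    finally have "r m * b (n - M) + r m * (Q * b (n - 1 - M)) - r m * b (n + M) - r m * (Q * b (n - 1 + M))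
       = - (Q * b (n - 1 - M)) + b (n + M)"
      using \<open>x \<noteq> 0\<close> by simp
    \<comment> \<open>Since \<open>M\<close> starts at 1, the lower tail of
      \<open>b (n - 1 - M)\<close> starts at \<open>n - 2\<close>.\<close>
    moreover have "n - 2 - int m = n - 1 - M" by (simp add: M_def)
    ultimately show "- (Q * b (n - 2 - int m)) + b (n + int (Suc m)) =
      r m * (b (n - int (Suc m)) - b (n + int (Suc m)))
      + Q * (r m * (b (n - 1 - int (Suc m)) - b (n - 1 + int (Suc m))))"
      by (simp only: M_def[symmetric]) (simp add: algebra_simps)
  qed
  finally have "((\<lambda>m. r m * (b (n - int (Suc m)) - b (n + int (Suc m)))
      + Q * (r m * (b (n - 1 - int (Suc m)) - b (n - 1 + int (Suc m)))))
      has_sum (- (Q * c (n - 2)) + - c n)) UNIV" .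
  moreover have "((\<lambda>m. r m * (b (n - int (Suc m)) - b (n + int (Suc m)))
      + Q * (r m * (b (n - 1 - int (Suc m)) - b (n - 1 + int (Suc m)))))
      has_sum (s n + Q * s (n - 1))) UNIV"
    by (intro has_sum_add has_sum_cmult_right has_sum_s)
  ultimately show ?thesis
    unfolding Q_def[symmetric] using has_sum_unique by fastforce
qed

lemma coefficient_identity: "of_int n * b n + c n + s n = 0"
proof -
  define h where "h n = of_int n * b n + c n + s n" for n
  have step: "h n = - (qpow \<tau> (of_int n) * h (n - 1))" for n
  proof -
    define Q where "Q = qpow \<tau> (of_int n)"
    have "h n + Q * h (n - 1) = of_int n * b n + (of_int n - 1) * (Q * b (n - 1)) + c n + Q * c (n - 1)
        + (s n + Q * s (n - 1))"
      by (simp add: h_def algebra_simps)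
    \<comment> \<open>The multiples of \<open>b n\<close> collapse because n - (n-1) = 1, and
      \<open>c n\<close> cancels against \<open>s_shift\<close>.\<close>
    also have "\<dots> = b n + Q * (c (n - 1) - c (n - 2))"
    proof -
      have "Q * b (n - 1) = - b n" by (simp add: b_shift[of n] Q_def)
      then show ?thesis
        by (simp only: s_shift[of n, folded Q_def]) (simp add: algebra_simps)
    qed
    also have "\<dots> = 0"
      using c_step[of "n - 1"] b_shift[of n] by (simp add: Q_def)
    finally show ?thesis by (simp add: Q_def eq_neg_iff_add_eq_0)
  qed
  have "h (- 1) = - b (- 1) + c (- 1) + s (- 1)" by (simp add: h_def)
  also have "\<dots> = c 0 + s 0"
    \<comment> \<open>Here \<open>- b (- 1) = b 0\<close>, and \<open>b 0 + c (- 1)\<close> is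
      \<open>c 0\<close>.\<close>
    using b_reflect[of 0] s_reflect[of 0] c_step[of 0] by simp
  finally have "h 0 = h (- 1)" by (simp add: h_def)
  moreover have "h 0 = - h (- 1)"
    using step[of 0] by (simp add: qpow_def)
  ultimately have "h 0 = 0" by simp
  have "h n = 0"
  proof (induction n rule: int_induct[where k = 0])
    case base
    show ?case by fact
  next
    case (step1 i)
    then show ?case using step[of "i + 1"] by simp
  next
    case (step2 i)
    \<comment> \<open>Downwards the recurrence is solved for \<open>h (i - 1)\<close>, which is
      possible because an exponential never vanishes.\<close>
    then show ?case using step[of i] by (simp add: qpow_def)
  qed
  then show ?thesis by (simp add: h_def)
qed

end

section \<open>Bernoulli numbers and polynomials\<close>

definition bernoulli_fps :: "complex fps" where
  "bernoulli_fps = Abs_fps (\<lambda>n. of_real (bernoulli n) / fact n)"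

lemma bernoulli_0: "bernoulli 0 = 1"
  by (simp add: bernoulli.simps)

lemma bernoulli_recurrence:
  assumes "n > 0"
  shows "(\<Sum>k\<le>n. of_nat (Suc n choose k) * bernoulli k) = 0"
proof -
  have "(\<Sum>k\<le>n. of_nat (Suc n choose k) * bernoulli k)
      = (\<Sum>k<n. of_nat (Suc n choose k) * bernoulli k) + of_nat (Suc n) * bernoulli n"
    by (simp add: lessThan_Suc_atMost[symmetric] del: of_nat_Suc)
  also have "of_nat (Suc n) * bernoulli n = - (\<Sum>k<n. of_nat (Suc n choose k) * bernoulli k)"
    using assms by (subst bernoulli.simps) (simp del: of_nat_Suc)
  finally show ?thesis by simp
qed

text \<open>Identifies the exponential generating function as t/(e^t - 1): multiplied by n!, the
  coefficients of the product are the sums in the defining recurrence.\<close>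

lemma bernoulli_fps_mult: "bernoulli_fps * (fps_exp 1 - 1) = fps_X"
proof (rule fps_ext)
  fix n
  show "(bernoulli_fps * (fps_exp 1 - 1)) $ n = (fps_X :: complex fps) $ n"
  proof (cases n)
    case 0
    then show ?thesis by simp
  next
    case (Suc m)
    have "(bernoulli_fps * (fps_exp 1 - 1)) $ n
        = (\<Sum>i=0..n. of_real (bernoulli i) / fact i * (fps_exp 1 - 1 :: complex fps) $ (n - i))"
      by (simp add: fps_mult_nth bernoulli_fps_def)
    also have "\<dots> = (\<Sum>i\<le>m. of_real (bernoulli i) / fact i * (fps_exp 1 - 1 :: complex fps) $ (n - i))"
      by (simp add: Suc atLeast0AtMost mult.commute)
    also have "\<dots> = (\<Sum>i\<le>m. of_real (of_nat (n choose i) * bernoulli i) / fact n)"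
    proof (intro sum.cong refl)
      fix i assume "i \<in> {..m}"
      then have i: "i \<le> n" "n - i \<noteq> 0" using Suc by auto
      show "of_real (bernoulli i) / fact i * (fps_exp 1 - 1 :: complex fps) $ (n - i)
         = of_real (of_nat (n choose i) * bernoulli i) / fact n"
        using i(2) by (simp add: binomial_fact[OF i(1)] field_simps)
    qed
    also have "\<dots> = of_real (\<Sum>i\<le>m. of_nat (n choose i) * bernoulli i) / fact n"
      by (simp add: sum_divide_distrib)
    also have "\<dots> = (fps_X :: complex fps) $ n"
      using bernoulli_recurrence[of m] by (cases "m = 0") (auto simp: Suc bernoulli_0 fps_X_def)
    finally show ?thesis .
  qed
qed

text \<open>Replacing t by -t in t/(e^t - 1) only adds t, since e^t (e^(-t) - 1) = -(e^t - 1). Hence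
  every odd coefficient other than that of t equals its own negative.\<close>

lemma bernoulli_odd_eq_0:
  assumes "odd n" "n \<noteq> 1"
  shows "bernoulli n = 0"
proof -
  define R where "R = bernoulli_fps oo (- fps_X)"
  define E where "E = (fps_exp 1 :: complex fps)"
  have E: "E * fps_exp (- 1) = 1" unfolding E_def by (simp add: fps_exp_add_mult[symmetric])
  have "R * (fps_exp (- 1) - 1) = (bernoulli_fps * (E - 1)) oo (- fps_X)"
    by (simp add: R_def E_def fps_compose_mult_distrib fps_compose_sub_distrib)
  also have "\<dots> = - fps_X" by (simp add: E_def bernoulli_fps_mult)
  finally have R: "R * (fps_exp (- 1) - 1) = - fps_X" .
  have "R * (E - 1) = - (E * (R * (fps_exp (- 1) - 1)))"
    using E by (simp add: algebra_simps)
  also have "\<dots> = (bernoulli_fps + fps_X) * (E - 1)"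
    unfolding R using bernoulli_fps_mult by (simp add: E_def algebra_simps)
  finally have "R = bernoulli_fps + fps_X"
    by (simp add: E_def)
  then have "R $ n = bernoulli_fps $ n"
    using assms by (simp add: fps_X_def)
  moreover have "R $ n = (- 1) ^ n * bernoulli_fps $ n"
    by (simp add: R_def fps_compose_uminus')
  ultimately show ?thesis
    using assms by (simp add: bernoulli_fps_def)
qed

section \<open>Bernoulli polynomials and their difference equation\<close>

definition bernoulli_poly :: "nat \<Rightarrow> complex \<Rightarrow> complex" where
  "bernoulli_poly p x = (\<Sum>j\<le>p. of_nat (p choose j) * of_real (bernoulli j) * x ^ (p - j))"

lemma bernoulli_poly_fps: "bernoulli_poly p x = fact p * (bernoulli_fps * fps_exp x) $ p"
  unfolding fps_mult_nth sum_distrib_left bernoulli_poly_def atLeast0AtMost bernoulli_fps_def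
  by (intro sum.cong refl) (simp add: binomial_fact field_simps)

text \<open>Taking the difference multiplies the generating function t e^(xt)/(e^t - 1) by e^t - 1
  and leaves t e^(xt).\<close>

lemma bernoulli_poly_step: "bernoulli_poly (Suc p) (x + 1) - bernoulli_poly (Suc p) x = of_nat (Suc p) * x ^ p"
proof -
  have "bernoulli_poly (Suc p) (x + 1) - bernoulli_poly (Suc p) x
     = fact (Suc p) * (bernoulli_fps * fps_exp (x + 1) - bernoulli_fps * fps_exp x) $ Suc p"
    unfolding bernoulli_poly_fps by (simp add: algebra_simps)
  also have "bernoulli_fps * fps_exp (x + 1) - bernoulli_fps * fps_exp x
      = (bernoulli_fps * (fps_exp 1 - 1)) * fps_exp x"
    by (simp add: fps_exp_add_mult algebra_simps)
  also have "fact (Suc p) * (\<dots>) $ Suc p = of_nat (Suc p) * x ^ p"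
    by (simp add: bernoulli_fps_mult)
  finally show ?thesis .
qed

section \<open>Derivatives of the theta function\<close>

text \<open>Complex sine is unbounded; this growth bound is what the decay of \<open>b\<close> has
  to beat near 0.\<close>

lemma norm_sin_le_exp_norm: "norm (sin w) \<le> exp (norm (w :: complex))"
proof -
  have "norm (sin w) = norm (exp (\<i> * w) - exp (- (\<i> * w))) / 2"
    by (simp add: sin_exp_eq norm_divide norm_mult)
  also have "\<dots> \<le> (norm (exp (\<i> * w)) + norm (exp (- (\<i> * w)))) / 2"
    by (intro divide_right_mono norm_triangle_ineq4) simp
  also have "\<dots> \<le> (exp (norm (\<i> * w)) + exp (norm (- (\<i> * w)))) / 2"
    by (intro divide_right_mono add_mono norm_exp) simp
  also have "\<dots> = exp (norm w)" by (simp add: norm_mult)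
  finally show ?thesis by simp
qed

lemma higher_deriv_sin_even: "(deriv ^^ (2 * n)) sin = (\<lambda>z :: complex. (- 1) ^ n * sin z)"
proof (induction n)
  case (Suc n)
  have d1: "deriv (\<lambda>z :: complex. (- 1) ^ n * sin z) = (\<lambda>z. (- 1) ^ n * cos z)"
    by (intro ext DERIV_imp_deriv) (auto intro!: derivative_eq_intros)
  have d2: "deriv (\<lambda>z :: complex. (- 1) ^ n * cos z) = (\<lambda>z. (- 1) ^ Suc n * sin z)"
    by (intro ext DERIV_imp_deriv) (auto intro!: derivative_eq_intros)
  show ?case using Suc by (simp add: d1 d2)
qed simp

lemma higher_deriv_sin_odd_0: "(deriv ^^ (2 * n + 1)) sin (0 :: complex) = (- 1) ^ n"
proof -
  have "deriv (\<lambda>z :: complex. (- 1) ^ n * sin z) 0 = (- 1) ^ n"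
    by (intro DERIV_imp_deriv) (auto intro!: derivative_eq_intros)
  then show ?thesis by (simp add: higher_deriv_sin_even)
qed

lemma higher_deriv_sine_sum:
  fixes a :: "nat \<Rightarrow> complex"
  shows "(deriv ^^ k) (\<lambda>z. \<Sum>n<N. a n * sin (u n * z)) z
       = (\<Sum>n<N. a n * (u n ^ k * (deriv ^^ k) sin (u n * z)))"
proof (induction N)
  case 0
  show ?case by simp
next
  case (Suc N)
  have "(deriv ^^ k) (\<lambda>z. a N * sin (u N * z)) z = a N * (u N ^ k * (deriv ^^ k) sin (u N * z))"
    by (subst higher_deriv_cmult[where A = UNIV])
       (auto intro!: holomorphic_intros higher_deriv_compose_linear[where S = UNIV and T = UNIV])
  moreover have "(deriv ^^ k) (\<lambda>z. (\<Sum>n<N. a n * sin (u n * z)) + a N * sin (u N * z)) z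
      = (deriv ^^ k) (\<lambda>z. \<Sum>n<N. a n * sin (u n * z)) z + (deriv ^^ k) (\<lambda>z. a N * sin (u N * z)) z"
    by (rule higher_deriv_add[where S = UNIV]) (auto intro!: holomorphic_intros)
  ultimately show ?case using Suc by simp
qed

context upper_half_plane_point
begin

text \<open>With the radius as \<open>\<delta>\<close>, the decay exp(-2 \<open>\<delta>\<close>
  (2n+1)) from \<open>norm_b_le\<close> outweighs the growth exp(\<open>\<delta>\<close> (2n+1)) of
  the sine, leaving a geometric majorant. A disc around 0 suffices for derivatives at 0.\<close>

lemma uniform_limit_theta1:
  defines "D \<equiv> ball 0 (pi * Im \<tau> / 8)"
  shows "uniform_limit D (\<lambda>N z. 2 * (\<Sum>n<N. b (int n) * sin (of_nat (2 * n + 1) * z))) (theta1 \<tau>) sequentially"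
proof -
  define \<delta> where "\<delta> = pi * Im \<tau> / 8"
  define x where "x = exp (- \<delta>)"
  have \<delta>: "\<delta> > 0" using Im_pos by (simp add: \<delta>_def)
  then have x: "0 < x" "x < 1" by (auto simp: x_def)
  have "uniform_limit D (\<lambda>N z. \<Sum>n<N. b (int n) * sin (of_nat (2 * n + 1) * z))
          (\<lambda>z. \<Sum>n. b (int n) * sin (of_nat (2 * n + 1) * z)) sequentially"
  proof (rule Weierstrass_m_test)
    show "summable (\<lambda>n. x ^ Suc n)"
      using x summable_power_times_geometric[of x 0] by simp
    fix n z assume "z \<in> D"
    then have z: "norm z \<le> \<delta>" by (simp add: D_def \<delta>_def)
    define t where "t = real (2 * n + 1)"
    have t: "t \<ge> 0" by (simp add: t_def)
    have "norm (b (int n)) \<le> exp (- (2 * \<delta> * t))"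
      using norm_b_le[of "int n"] by (simp add: \<delta>_def t_def add.commute)
    moreover have "norm (sin (of_nat (2 * n + 1) * z)) \<le> exp (t * \<delta>)"
    proof -
      have "norm (of_nat (2 * n + 1) * z) = t * norm z"
        by (simp only: norm_mult norm_of_nat t_def)
      also have "\<dots> \<le> t * \<delta>" using z t by (rule mult_left_mono)
      finally show ?thesis
        using norm_sin_le_exp_norm[of "of_nat (2 * n + 1) * z"] by (meson exp_le_cancel_iff order_trans)
    qed
    ultimately have "norm (b (int n)) * norm (sin (of_nat (2 * n + 1) * z)) \<le> exp (- (2 * \<delta> * t)) * exp (t * \<delta>)"
      by (intro mult_mono) auto
    also have "\<dots> = x ^ (2 * n + 1)"
      unfolding x_def exp_of_nat_mult[symmetric] t_def exp_add[symmetric] by (simp add: algebra_simps)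
    also have "\<dots> \<le> x ^ Suc n"
      using x by (intro power_decreasing) auto
    finally show "norm (b (int n) * sin (of_nat (2 * n + 1) * z)) \<le> x ^ Suc n"
      by (simp add: norm_mult)
  qed
  then have "uniform_limit D (\<lambda>N z. 2 * (\<Sum>n<N. b (int n) * sin (of_nat (2 * n + 1) * z)))
          (\<lambda>z. 2 * (\<Sum>n. b (int n) * sin (of_nat (2 * n + 1) * z))) sequentially"
    by (rule bounded_linear.uniform_limit[OF bounded_linear_mult_right])
  also have "(\<lambda>z. 2 * (\<Sum>n. b (int n) * sin (of_nat (2 * n + 1) * z))) = theta1 \<tau>"
  proof -
    have *: "(of_int (2 * int n + 1))\<^sup>2 / (8 :: real) = (of_nat n + 1 / 2)\<^sup>2 / 2" for n
      by (simp add: power2_eq_square field_simps)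
    have "b (int n) = (- 1) ^ n * qpow \<tau> ((of_nat n + 1 / 2)\<^sup>2 / 2)" for n
      unfolding b_def * by simp
    then show ?thesis by (simp add: theta1_def fun_eq_iff)
  qed
  finally show ?thesis .
qed

text \<open>Locally uniform limits of holomorphic functions commute with derivatives, so the
  derivatives of the partial sums at 0 converge both to the derivative of \<open>theta1\<close> and
  to the series of \<open>S3_odd\<close>.\<close>

lemma higher_deriv_theta1_0: "(deriv ^^ (2 * \<nu> + 1)) (theta1 \<tau>) 0 = 2 * (- 1) ^ \<nu> * S3 \<tau> (2 * \<nu> + 1)"
proof (rule LIMSEQ_unique)
  show "(\<lambda>N. (deriv ^^ (2 * \<nu> + 1)) (\<lambda>z. 2 * (\<Sum>n<N. b (int n) * sin (of_nat (2 * n + 1) * z))) 0)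
     \<longlonglongrightarrow> (deriv ^^ (2 * \<nu> + 1)) (theta1 \<tau>) 0"
    using Im_pos by (intro higher_deriv_complex_uniform_limit[OF uniform_limit_theta1] always_eventually allI)
       (auto intro!: holomorphic_intros)
  have "(deriv ^^ (2 * \<nu> + 1)) (\<lambda>z. 2 * (\<Sum>n<N. b (int n) * sin (of_nat (2 * n + 1) * z))) 0
      = 2 * (- 1) ^ \<nu> * (\<Sum>n<N. of_nat (2 * n + 1) ^ (2 * \<nu> + 1) * b (int n))" for N
  proof -
    have "(deriv ^^ (2 * \<nu> + 1)) (\<lambda>z. 2 * (\<Sum>n<N. b (int n) * sin (of_nat (2 * n + 1) * z))) 0
      = 2 * (deriv ^^ (2 * \<nu> + 1)) (\<lambda>z. \<Sum>n<N. b (int n) * sin (of_nat (2 * n + 1) * z)) 0"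
      by (rule higher_deriv_cmult[where A = UNIV]) (auto intro!: holomorphic_intros)
    also have "\<dots> = 2 * (\<Sum>n<N. b (int n) * (of_nat (2 * n + 1) ^ (2 * \<nu> + 1) * (- 1) ^ \<nu>))"
      unfolding higher_deriv_sine_sum mult_zero_right higher_deriv_sin_odd_0 ..
    finally show ?thesis by (simp only: sum_distrib_left mult_ac)
  qed
  moreover have "(\<lambda>N. 2 * (- 1) ^ \<nu> * (\<Sum>n<N. of_nat (2 * n + 1) ^ (2 * \<nu> + 1) * b (int n)))
     \<longlonglongrightarrow> 2 * (- 1) ^ \<nu> * S3 \<tau> (2 * \<nu> + 1)"
    using has_sum_imp_sums[OF has_sum_b_half[of "2 * \<nu> + 1"]]
    by (intro tendsto_mult tendsto_const) (simp add: S3_odd sums_def)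
  ultimately show "(\<lambda>N. (deriv ^^ (2 * \<nu> + 1)) (\<lambda>z. 2 * (\<Sum>n<N. b (int n) * sin (of_nat (2 * n + 1) * z))) 0)
     \<longlonglongrightarrow> 2 * (- 1) ^ \<nu> * S3 \<tau> (2 * \<nu> + 1)"
    by simp
qed

section \<open>The moment identity\<close>

text \<open>Solve \<open>coefficient_identity\<close> for \<open>c\<close>, writing n = ((2n+1) -
  1)/2 so that only powers of 2n+1 occur.\<close>

lemma has_sum_c_moment:
  "((\<lambda>N. of_int (2 * N + 1) ^ k * c N) has_sum
     ((A k - A (Suc k)) / 2 - (\<Sum>j\<le>k. of_nat (k choose j) * (1 - (- 1) ^ j) * 2 ^ j * Phi j q * A (k - j)))) UNIV"
proof -
  have c: "c N = b N / 2 - of_int (2 * N + 1) * b N / 2 - s N" for N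
    using coefficient_identity[of N] by (simp add: field_simps) (simp add: algebra_simps eq_neg_iff_add_eq_0)
  have "of_int (2 * N + 1) ^ k * c N = (of_int (2 * N + 1) ^ k * b N) * (1 / 2)
      - (of_int (2 * N + 1) ^ Suc k * b N) * (1 / 2) - of_int (2 * N + 1) ^ k * s N" for N
    by (simp add: c algebra_simps)
  then show ?thesis
    using has_sum_diff[OF has_sum_diff[OF has_sum_A[of k, THEN has_sum_cmult_left, of "1/2"]
            has_sum_A[of "Suc k", THEN has_sum_cmult_left, of "1/2"]] has_sum_s_moment[of k]]
    by (simp only:) (simp add: diff_divide_distrib)
qed

text \<open>Two evaluations of the moment of \<open>c\<close> of order \<open>2 * \<nu>\<close>: by
  summation by parts against a polynomial primitive of the power, and by
  \<open>has_sum_c_moment\<close>.\<close>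

lemma moment_identity:
  fixes \<nu> :: nat
  defines "p \<equiv> 2 * \<nu> + 1"
  shows "(\<Sum>j\<le>p. of_nat (p choose j) * of_real (bernoulli j) * 2 ^ j * A (p - j)) / of_nat p
    = A p + 2 * (\<Sum>j\<le>2 * \<nu>. of_nat ((2 * \<nu>) choose j) * (1 - (- 1) ^ j) * 2 ^ j * Phi j q * A (2 * \<nu> - j))"
    (is "?L = A p + 2 * ?M")
proof -
  \<comment> \<open>Coefficients of 2^p/p times the Bernoulli polynomial at half the argument:
    moving \<open>N\<close> by 1 moves the odd number by 2 but its half by 1.\<close>
  define w where "w j = of_nat (p choose j) * of_real (bernoulli j) * 2 ^ j / (of_nat p :: complex)" for j
  define P where "P N = (\<Sum>j\<le>p. w j * of_int (2 * N + 1) ^ (p - j))" for N :: int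
  have P_eq: "P N = 2 ^ p / of_nat p * bernoulli_poly p (of_int (2 * N + 1) / 2)" for N
    unfolding P_def bernoulli_poly_def sum_distrib_left
  proof (intro sum.cong refl)
    fix j assume "j \<in> {..p}"
    then have "(2 :: complex) ^ p = 2 ^ j * 2 ^ (p - j)" by (simp add: power_add[symmetric])
    then show "w j * of_int (2 * N + 1) ^ (p - j) = 2 ^ p / of_nat p *
         (of_nat (p choose j) * of_real (bernoulli j) * (of_int (2 * N + 1) / 2) ^ (p - j))"
      by (simp add: w_def power_divide del: of_int_add)
  qed
  have P_step: "P (N + 1) - P N = 2 * of_int (2 * N + 1) ^ (2 * \<nu>)" for N
  proof -
    define y where "y = of_int (2 * N + 1) / (2 :: complex)"
    have y: "of_int (2 * (N + 1) + 1) / 2 = y + 1" "of_int (2 * N + 1) = 2 * y"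
      by (simp_all add: y_def field_simps)
    have "P (N + 1) - P N = 2 ^ p / of_nat p * (bernoulli_poly p (y + 1) - bernoulli_poly p y)"
      unfolding P_eq y(1) y_def[symmetric] by (simp only: right_diff_distrib)
    also have "\<dots> = 2 ^ p * y ^ (2 * \<nu>)"
      using bernoulli_poly_step[of "2 * \<nu>" y] by (simp add: p_def del: of_nat_Suc of_nat_mult)
    finally show ?thesis unfolding y(2) by (simp add: p_def power_mult_distrib)
  qed
  have "((\<lambda>N. \<Sum>j\<le>p. w j * (of_int (2 * N + 1) ^ (p - j) * b N)) has_sum (\<Sum>j\<le>p. w j * A (p - j))) UNIV"
    by (intro has_sum_finite_sum has_sum_cmult_right has_sum_A)
  moreover have "(\<Sum>j\<le>p. w j * A (p - j)) = ?L"
    by (simp add: w_def sum_divide_distrib)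
  ultimately have bL: "((\<lambda>N. P N * b N) has_sum ?L) UNIV"
    by (simp add: P_def sum_distrib_right mult.assoc)
  \<comment> \<open>Only the existence of this sum matters; its value \<open>u\<close> cancels
    below.\<close>
  obtain u where "((\<lambda>N. \<Sum>j\<le>p. w j * (of_int (2 * N + 1) ^ (p - j) * c N)) has_sum u) UNIV"
    using has_sum_finite_sum[OF has_sum_cmult_right[OF has_sum_c_moment]] by blast
  then have cu: "((\<lambda>N. P N * c N) has_sum u) UNIV"
    by (simp add: P_def sum_distrib_right mult.assoc)
  have "((\<lambda>N. P N * c N - P N * b N) has_sum (u - ?L)) UNIV"
    by (rule has_sum_diff[OF cu bL])
  also have "(\<lambda>N. P N * c N - P N * b N) = (\<lambda>N. P N * c (N - 1))"
    by (rule ext, subst c_step) (simp add: algebra_simps)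
  finally have "((\<lambda>N. P (N + 1) * c N) has_sum (u - ?L)) UNIV"
    by (subst has_sum_reindex_bij_witness[where i = "\<lambda>N. N - 1" and j = "\<lambda>N. N + 1" and T = UNIV
          and h = "\<lambda>N. P N * c (N - 1)"]) auto
  \<comment> \<open>After the shift of index both sums carry \<open>c N\<close>, so their difference
    involves only \<open>P (N + 1) - P N\<close>.\<close>
  from has_sum_diff[OF this cu]
  have "((\<lambda>N. 2 * (of_int (2 * N + 1) ^ (2 * \<nu>) * c N)) has_sum - ?L) UNIV"
    by (simp only: left_diff_distrib[symmetric] P_step mult.assoc) simp
  from has_sum_unique[OF this has_sum_cmult_right[OF has_sum_c_moment]]
  have "- ?L = 2 * ((A (2 * \<nu>) - A (Suc (2 * \<nu>))) / 2 - ?M)" .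
  then have "?L = A p + 2 * ?M"
    by (simp add: A_even p_def algebra_simps)
  then show ?thesis .
qed

section \<open>Translation of the moments back to \<open>S3\<close>\<close>

lemma bernoulli_part:
  "(\<Sum>j\<le>2 * \<nu> + 1. of_nat ((2 * \<nu> + 1) choose j) * of_real (bernoulli j) * 2 ^ j * A (2 * \<nu> + 1 - j)) / of_nat (2 * \<nu> + 1)
   = 2 * (1 / of_nat (2 * \<nu> + 1) * S3 \<tau> (2 * \<nu> + 1)
       + (\<Sum>n = 1..2 * \<nu> - 1. of_real (bernoulli (n + 1)) / of_nat (n + 1) * 2 ^ (n + 1)
               * of_nat ((2 * \<nu>) choose n) * S3 \<tau> (2 * \<nu> - n)))"
proof -
  define p where "p = Suc (2 * \<nu>)"
  define f where "f n = of_real (bernoulli (Suc n)) / of_nat (Suc n) * 2 ^ Suc n * of_nat ((2 * \<nu>) choose n) * A (2 * \<nu> - n)" for n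
  have *: "of_nat (p choose Suc n) * of_real (bernoulli (Suc n)) * 2 ^ Suc n * A (p - Suc n) = of_nat p * f n" for n
  proof -
    \<comment> \<open>The absorption identity yields the denominator n+1 and cancels the division by
      \<open>p\<close>.\<close>
    have "of_nat (Suc n) * of_nat (p choose Suc n) = (of_nat p * of_nat ((2 * \<nu>) choose n) :: complex)"
      unfolding p_def of_nat_mult[symmetric] Suc_times_binomial_eq by (simp add: mult.commute)
    then have "of_nat (p choose Suc n) = of_nat p * of_nat ((2 * \<nu>) choose n) / (of_nat (Suc n) :: complex)"
      by (simp add: field_simps del: of_nat_Suc)
    then show ?thesis by (simp add: f_def p_def del: of_nat_Suc binomial_Suc_Suc)
  qed
  have "(\<Sum>j\<le>p. of_nat (p choose j) * of_real (bernoulli j) * 2 ^ j * A (p - j))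
      = A p + (\<Sum>n\<le>2 * \<nu>. of_nat (p choose Suc n) * of_real (bernoulli (Suc n)) * 2 ^ Suc n * A (p - Suc n))"
    unfolding p_def by (subst sum.atMost_Suc_shift) (simp add: bernoulli_0)
  also have "\<dots> = A p + of_nat p * (\<Sum>n\<le>2 * \<nu>. f n)"
    unfolding * by (simp only: sum_distrib_left)
  also have "(\<Sum>n\<le>2 * \<nu>. f n) = (\<Sum>n = 1..2 * \<nu> - 1. f n)"
  proof (rule sum.mono_neutral_right)
    show "\<forall>n\<in>{..2 * \<nu>} - {1..2 * \<nu> - 1}. f n = 0"
    proof
      fix n assume "n \<in> {..2 * \<nu>} - {1..2 * \<nu> - 1}"
      \<comment> \<open>At both ends the moment has even order, hence is 0. For
        \<open>\<nu> = 0\<close> truncated subtraction makes the target range empty, and the two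
        ends coincide.\<close>
      then have "n = 0 \<or> n = 2 * \<nu>" by auto
      then show "f n = 0" by (auto simp: f_def A_even)
    qed
  qed auto
  also have "\<dots> = (\<Sum>n = 1..2 * \<nu> - 1. 2 * (of_real (bernoulli (n + 1)) / of_nat (n + 1) * 2 ^ (n + 1)
               * of_nat ((2 * \<nu>) choose n) * S3 \<tau> (2 * \<nu> - n)))"
  proof (intro sum.cong refl)
    fix n assume n: "n \<in> {1..2 * \<nu> - 1}"
    show "f n = 2 * (of_real (bernoulli (n + 1)) / of_nat (n + 1) * 2 ^ (n + 1)
               * of_nat ((2 * \<nu>) choose n) * S3 \<tau> (2 * \<nu> - n))"
    \<comment> \<open>For even \<open>n\<close> the moment is not twice \<open>S3\<close>; the terms
      agree because the Bernoulli number of odd index \<open>n + 1\<close>, at least 3,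
      vanishes.\<close>
    proof (cases "odd n")
      case True
      with n have "odd (2 * \<nu> - n)" by auto
      then show ?thesis by (simp add: f_def A_odd)
    next
      case False
      with n have "bernoulli (Suc n) = 0" by (intro bernoulli_odd_eq_0) auto
      then show ?thesis by (simp add: f_def)
    qed
  qed
  finally have "(\<Sum>j\<le>p. of_nat (p choose j) * of_real (bernoulli j) * 2 ^ j * A (p - j)) / of_nat p
     = A p / of_nat p + (\<Sum>n = 1..2 * \<nu> - 1. 2 * (of_real (bernoulli (n + 1)) / of_nat (n + 1) * 2 ^ (n + 1)
               * of_nat ((2 * \<nu>) choose n) * S3 \<tau> (2 * \<nu> - n)))"
    by (simp add: add_divide_distrib p_def del: of_nat_Suc)
  moreover have "A p = 2 * S3 \<tau> p" by (simp add: A_odd p_def)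
  ultimately show ?thesis
    unfolding Suc_eq_plus1[symmetric] p_def[symmetric] by (simp add: sum_distrib_left distrib_left)
qed

text \<open>Even \<open>j\<close> drop out; for odd \<open>j = 2 * l - 1\<close> the factor
  \<open>1 - (- 1) ^ j\<close> equals 2 and raises 2^(2l-1) to 2^(2l), while \<open>A_odd\<close>
  gives the outer 2.\<close>

lemma Phi_part:
  "(\<Sum>j\<le>2 * \<nu>. of_nat ((2 * \<nu>) choose j) * (1 - (- 1) ^ j) * 2 ^ j * Phi j q * A (2 * \<nu> - j))
   = 2 * (\<Sum>l = 1..\<nu>. of_nat ((2 * \<nu>) choose (2 * l - 1)) * 2 ^ (2 * l)
               * S3 \<tau> (2 * (\<nu> - l) + 1) * Phi (2 * l - 1) q)"
proof -
  define f where "f j = of_nat ((2 * \<nu>) choose j) * (1 - (- 1) ^ j) * 2 ^ j * Phi j q * A (2 * \<nu> - j)" for j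
  have "(\<Sum>j\<le>2 * \<nu>. f j) = (\<Sum>j | odd j \<and> j \<le> 2 * \<nu>. f j)"
    by (rule sum.mono_neutral_right) (auto simp: f_def)
  also have "\<dots> = (\<Sum>l = 1..\<nu>. f (2 * l - 1))"
    by (rule sum.reindex_bij_witness[where i = "\<lambda>l. 2 * l - 1" and j = "\<lambda>j. (j + 1) div 2"])
       (auto elim!: oddE)
  also have "\<dots> = (\<Sum>l = 1..\<nu>. 2 * (of_nat ((2 * \<nu>) choose (2 * l - 1)) * 2 ^ (2 * l)
               * S3 \<tau> (2 * (\<nu> - l) + 1) * Phi (2 * l - 1) q))"
  proof (intro sum.cong refl)
    fix l assume l: "l \<in> {1..\<nu>}"
    then obtain i where i: "l = Suc i" by (cases l) auto
    have "2 * \<nu> - (2 * l - 1) = 2 * (\<nu> - l) + 1" using l by auto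
    moreover have "(1 - (- 1) ^ (2 * l - 1)) * 2 ^ (2 * l - 1) = (2 :: complex) ^ (2 * l)"
      by (simp add: i)
    ultimately show "f (2 * l - 1) = 2 * (of_nat ((2 * \<nu>) choose (2 * l - 1)) * 2 ^ (2 * l)
               * S3 \<tau> (2 * (\<nu> - l) + 1) * Phi (2 * l - 1) q)"
      by (simp add: f_def A_odd mult.assoc[of "of_nat _" "1 - _" "2 ^ _"])
  qed
  finally show ?thesis by (simp add: f_def sum_distrib_left)
qed

end

section \<open>The recurrence and the theta derivatives\<close>

theorem theorem3:
  fixes \<tau> q :: complex and \<nu> :: nat
  assumes "Im \<tau> > 0"
    and "q = exp (2 * of_real pi * \<i> * \<tau>)"
  shows "S3 \<tau> (2 * \<nu> + 1) =
           (\<Sum>n = 1..2 * \<nu> - 1. of_real (bernoulli (n + 1)) / of_nat (n + 1) * 2 ^ (n + 1)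
               * of_nat ((2 * \<nu>) choose n) * S3 \<tau> (2 * \<nu> - n))
           + 1 / of_nat (2 * \<nu> + 1) * S3 \<tau> (2 * \<nu> + 1)
           - 2 * (\<Sum>l = 1..\<nu>. of_nat ((2 * \<nu>) choose (2 * l - 1)) * 2 ^ (2 * l)
               * S3 \<tau> (2 * (\<nu> - l) + 1) * Phi (2 * l - 1) q)
         \<and> (deriv ^^ (2 * \<nu> + 1)) (theta1 \<tau>) 0 = 2 * (-1) ^ \<nu> * S3 \<tau> (2 * \<nu> + 1)"
    (is "?S = ?Y + ?Z - 2 * ?X \<and> _")
proof
  interpret upper_half_plane_point \<tau> by unfold_locales (fact assms(1))
  have q: "upper_half_plane_point.q \<tau> = q" by (simp add: q_def assms(2))
  have "2 * (?Z + ?Y) = A (2 * \<nu> + 1) + 2 * (2 * ?X)"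
    using moment_identity[of \<nu>] unfolding bernoulli_part Phi_part unfolding q .
  then have "2 * (?Z + ?Y) = 2 * ?S + 2 * (2 * ?X)"
    by (simp only: A_odd odd_two_times_div_two_succ even_mult_iff even_add) (simp add: A_odd)
  \<comment> \<open>The common factor 2 stems from \<open>A_odd\<close>, that is, from folding
    two-sided moments.\<close>
  then have "?Z + ?Y = ?S + 2 * ?X" by (simp only: distrib_left[symmetric] mult_cancel_left) simp
  then show "?S = ?Y + ?Z - 2 * ?X" by (simp only: eq_diff_eq add.commute)
  show "(deriv ^^ (2 * \<nu> + 1)) (theta1 \<tau>) 0 = 2 * (-1) ^ \<nu> * S3 \<tau> (2 * \<nu> + 1)"
    by (rule higher_deriv_theta1_0)
qed

end
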